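(* Let $p\in(0,\tfrac12]$, $\rho\in(0,1)$ and $\varepsilon>0$. Let $r=\frac{\log(2/\varepsilon)}{\log(1/\rho)}$ and $\delta=10^{-3r-1}\varepsilon^3$. Suppose $f:\{0,1\}^n\to\{0,1\}$ is an $(r,\delta)$-global Boolean function with $\mu_p(f)<\delta$. Then $\mathrm{Stab}_\rho(f)\le\varepsilon\mu_p(f)$.
   Context: $\mu_p$ is the $p$-biased product measure on $\{0,1\}^n$. $\mathrm{T}_\rho f(x)=\mathbb{E}_{\mathbf y\sim N_\rho(x)}f(\mathbf y)$, where each $\mathbf y_i=x_i$ with probability $\rho$ and is otherwise resampled with $\Pr[\mathbf y_i=1]=p$; $\mathrm{Stab}_\rho(f)=\mathbb{E}_{\mu_p}[f\,\mathrm{T}_\rho f]$. For $J\subseteq[n]$, $f_{J\to1}$ sets the coordinates of $J$ to $1$; $f$ is $(r,\delta)$-global if $\mu_p(f_{J\to1})\le\mu_p(f)+\delta$ for all $J$ with $|J|\le r$. *)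

theory Defs
  imports "HOL-Probability.Probability"
begin

text \<open>
  Coordinates are the indices \<open>i < n\<close>, with \<^const>\<open>True\<close> for 1 and \<^const>\<open>False\<close> for 0.
  A point of the cube is a function on all naturals; being \<^const>\<open>False\<close> from \<open>n\<close> on
  makes the representation unique and agrees with the default value given to \<^const>\<open>Pi_pmf\<close>.
\<close>

definition cube :: "nat \<Rightarrow> (nat \<Rightarrow> bool) set" where
  "cube n = PiE_dflt {..<n} False (\<lambda>_. UNIV)"

definition biased_pmf :: "nat \<Rightarrow> real \<Rightarrow> (nat \<Rightarrow> bool) pmf" where
  "biased_pmf n p = Pi_pmf {..<n} False (\<lambda>_. bernoulli_pmf p)"

definition mu :: "nat \<Rightarrow> real \<Rightarrow> ((nat \<Rightarrow> bool) \<Rightarrow> real) \<Rightarrow> real" where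
  "mu n p f = measure_pmf.expectation (biased_pmf n p) f"

definition noise_pmf :: "nat \<Rightarrow> real \<Rightarrow> real \<Rightarrow> (nat \<Rightarrow> bool) \<Rightarrow> (nat \<Rightarrow> bool) pmf" where
  "noise_pmf n p \<rho> x = Pi_pmf {..<n} False
     (\<lambda>i. bind_pmf (bernoulli_pmf \<rho>)
       (\<lambda>keep. if keep then return_pmf (x i) else bernoulli_pmf p))"

definition noise_op ::
  "nat \<Rightarrow> real \<Rightarrow> real \<Rightarrow> ((nat \<Rightarrow> bool) \<Rightarrow> real) \<Rightarrow> (nat \<Rightarrow> bool) \<Rightarrow> real" where
  "noise_op n p \<rho> f x = measure_pmf.expectation (noise_pmf n p \<rho> x) f"

definition Stab :: "nat \<Rightarrow> real \<Rightarrow> real \<Rightarrow> ((nat \<Rightarrow> bool) \<Rightarrow> real) \<Rightarrow> real" where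
  "Stab n p \<rho> f = mu n p (\<lambda>x. f x * noise_op n p \<rho> f x)"

text \<open>
  The restriction is kept as a function on the whole cube that ignores the coordinates in \<open>J\<close>,
  so its mean is again taken with respect to the measure on all \<open>n\<close> coordinates.
\<close>

definition restrict_to_1 ::
  "nat set \<Rightarrow> ((nat \<Rightarrow> bool) \<Rightarrow> real) \<Rightarrow> (nat \<Rightarrow> bool) \<Rightarrow> real" where
  "restrict_to_1 J f x = f (\<lambda>i. if i \<in> J then True else x i)"

text \<open>The radius \<open>r\<close> is real: it is used with non-integral values.\<close>

definition is_global ::
  "nat \<Rightarrow> real \<Rightarrow> real \<Rightarrow> real \<Rightarrow> ((nat \<Rightarrow> bool) \<Rightarrow> real) \<Rightarrow> bool" where
  "is_global n p r \<delta> f \<longleftrightarrow>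
     (\<forall>J \<subseteq> {..<n}. real (card J) \<le> r \<longrightarrow> mu n p (restrict_to_1 J f) \<le> mu n p f + \<delta>)"

end

theory Submission
  imports Defs
begin

text \<open>
  Expand \<open>f\<close> as \<open>\<Sum>S. c S * (\<Prod>i\<in>S. x i - p)\<close> and split \<open>Stab\<close> at degree \<open>d = \<lfloor>r\<rfloor>\<close>.
  Degrees above \<open>d\<close> contribute at most \<open>\<rho> powr r * mu f = \<epsilon>/2 * mu f\<close>. The weight \<open>W\<close> of
  the part \<open>g\<close> of degree at most \<open>d\<close> satisfies
  \<open>W = E[f g] \<le> 3/4 s * mu f + E[g^4] / (4 s^3)\<close> with \<open>s = \<epsilon>/2\<close>,
  because \<open>f\<close> is Boolean. A hypercontractive inequality bounds \<open>E[g^4]\<close> by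
  \<open>32^d * W\<close> times the largest squared norm of a discrete derivative of \<open>f\<close> of order at most
  \<open>d\<close>, and globalness makes the latter at most \<open>8^d * \<delta>\<close>, so that \<open>E[g^4] \<le> s^3 * W\<close>.
\<close>

section \<open>Biased characters and expansions on a finite index set\<close>

text \<open>Left unnormalised: mean 0 and variance \<open>p * (1 - p)\<close>. This avoids square
  roots, at the price of a weight \<open>(p * (1 - p)) ^ card S\<close> on every squared
  coefficient.\<close>

definition chi :: "real \<Rightarrow> bool \<Rightarrow> real" where
  "chi p b = of_bool b - p"

definition expansion ::
  "real \<Rightarrow> 'a set \<Rightarrow> ('a set \<Rightarrow> real) \<Rightarrow> ('a \<Rightarrow> bool) \<Rightarrow> real" where
  "expansion p A c x = (\<Sum>S\<in>Pow A. c S * (\<Prod>i\<in>S. chi p (x i)))"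

abbreviation product_pmf :: "real \<Rightarrow> 'a set \<Rightarrow> ('a \<Rightarrow> bool) pmf" where
  "product_pmf p A \<equiv> Pi_pmf A False (\<lambda>_. bernoulli_pmf p)"

definition expect :: "real \<Rightarrow> 'a set \<Rightarrow> (('a \<Rightarrow> bool) \<Rightarrow> real) \<Rightarrow> real" where
  "expect p A h = measure_pmf.expectation (product_pmf p A) h"

text \<open>The mean square of the discrete derivative of \<open>expansion p A c\<close> along the coordinates
  in \<open>R\<close>, without the normalising factor \<open>(p * (1 - p)) ^ card R\<close>.\<close>

definition influence :: "real \<Rightarrow> 'a set \<Rightarrow> 'a set \<Rightarrow> ('a set \<Rightarrow> real) \<Rightarrow> real" where
  "influence p A R c =
     (\<Sum>S\<in>Pow A. if R \<subseteq> S then (p * (1 - p)) ^ (card S - card R) * (c S)\<^sup>2 else 0)"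

text \<open>The noise operator acting on coefficients. It is used with \<open>t = \<rho>\<close> for
  the stability and with \<open>t = 1/2\<close> for hypercontractivity.\<close>

definition damp :: "real \<Rightarrow> ('a set \<Rightarrow> real) \<Rightarrow> 'a set \<Rightarrow> real" where
  "damp t c S = t ^ card S * c S"

section \<open>Expectations under product measures, one coordinate at a time\<close>

lemma finite_set_Pi_pmf_bool:
  fixes q :: "'a \<Rightarrow> bool pmf"
  assumes "finite A"
  shows "finite (set_pmf (Pi_pmf A d q))"
proof (rule finite_subset)
  show "set_pmf (Pi_pmf A d q) \<subseteq> PiE_dflt A d (\<lambda>_. UNIV)"
    using set_Pi_pmf_subset[OF assms] by (fastforce simp: PiE_dflt_def)
  show "finite (PiE_dflt A d (\<lambda>_. UNIV :: bool set))"
    using assms by (intro finite_PiE_dflt) auto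
qed

text \<open>The marginals may vary with the coordinate because those of the noise distribution
  depend on \<open>x i\<close>.\<close>

lemma expectation_Pi_pmf_insert:
  fixes q :: "'a \<Rightarrow> bool pmf" and h :: "('a \<Rightarrow> bool) \<Rightarrow> real"
  assumes "finite A" "i \<notin> A"
  shows "measure_pmf.expectation (Pi_pmf (insert i A) d q) h =
    pmf (q i) True * measure_pmf.expectation (Pi_pmf A d q) (\<lambda>x. h (x(i := True))) +
    pmf (q i) False * measure_pmf.expectation (Pi_pmf A d q) (\<lambda>x. h (x(i := False)))"
proof -
  have "Pi_pmf (insert i A) d q =
      q i \<bind> (\<lambda>b. map_pmf (\<lambda>x. x(i := b)) (Pi_pmf A d q))"
    using assms by (simp add: Pi_pmf_insert' map_pmf_def)
  then show ?thesis
    using finite_set_Pi_pmf_bool[OF assms(1), of d q]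
    by (simp only:) (subst pmf_expectation_bind[of UNIV], auto simp: UNIV_bool)
qed

lemma expect_insert:
  assumes "0 \<le> p" "p \<le> 1" "finite A" "i \<notin> A"
  shows "expect p (insert i A) h =
    p * expect p A (\<lambda>x. h (x(i := True))) + (1 - p) * expect p A (\<lambda>x. h (x(i := False)))"
  using assms by (simp add: expect_def expectation_Pi_pmf_insert)

lemma expect_empty [simp]: "expect p {} h = h (\<lambda>_. False)"
  by (simp add: expect_def)

lemma integrable_product_pmf:
  fixes h :: "('a \<Rightarrow> bool) \<Rightarrow> real"
  shows "finite A \<Longrightarrow> integrable (product_pmf p A) h"
  by (intro integrable_measure_pmf_finite finite_set_Pi_pmf_bool)

lemma expect_add:
  "finite A \<Longrightarrow> expect p A (\<lambda>x. g x + h x) = expect p A g + expect p A h"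
  unfolding expect_def by (intro Bochner_Integration.integral_add integrable_product_pmf)

lemma expect_cmult: "expect p A (\<lambda>x. k * h x) = k * expect p A h"
  unfolding expect_def by simp

lemma expect_const [simp]: "expect p A (\<lambda>x. k) = k"
  unfolding expect_def by simp

lemma set_product_pmf:
  assumes "finite A" "x \<in> set_pmf (product_pmf p A)"
  shows "Collect x \<subseteq> A"
  using assms set_Pi_pmf_subset[of A False "\<lambda>_. bernoulli_pmf p"] by blast

text \<open>The comparison is required only at points supported in \<open>A\<close>, since the
  Boolean function of the theorem is constrained only there.\<close>

lemma expect_mono:
  assumes "finite A" "\<And>x. Collect x \<subseteq> A \<Longrightarrow> g x \<le> h x"
  shows "expect p A g \<le> expect p A h"
  unfolding expect_def
proof (intro integral_mono_AE integrable_product_pmf AE_pmfI)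
  fix x assume "x \<in> set_pmf (product_pmf p A)"
  then show "g x \<le> h x"
    using assms(2) set_product_pmf[OF assms(1)] by blast
qed (fact assms(1))+

lemma expect_cong:
  assumes "finite A" "\<And>x. Collect x \<subseteq> A \<Longrightarrow> g x = h x"
  shows "expect p A g = expect p A h"
  by (intro antisym expect_mono) (simp_all add: assms)

lemma expect_nonneg:
  assumes "\<And>x. 0 \<le> h x"
  shows "0 \<le> expect p A h"
  unfolding expect_def using assms by simp

section \<open>Algebra and existence of expansions\<close>

lemma sum_Pow_insert:
  assumes "finite A" "i \<notin> A"
  shows "(\<Sum>S\<in>Pow (insert i A). g S) = (\<Sum>S\<in>Pow A. g S) + (\<Sum>S\<in>Pow A. g (insert i S))"
proof -
  have "inj_on (insert i) (Pow A)"
    using assms by (intro inj_onI) (metis PowD insert_ident subsetD)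
  moreover have "Pow A \<inter> insert i ` Pow A = {}"
    using assms by auto
  ultimately show ?thesis
    using assms by (simp add: Pow_insert sum.union_disjoint sum.reindex)
qed

text \<open>Sorting the sets by membership of \<open>i\<close> makes the expansion affine in
  \<open>chi p (x i)\<close>, with two coefficients that do not depend on coordinate
  \<open>i\<close>. The inductions on coordinates below rest on this.\<close>

lemma expansion_insert:
  assumes "finite A" "i \<notin> A"
  shows "expansion p (insert i A) c x =
    expansion p A c x + chi p (x i) * expansion p A (\<lambda>S. c (insert i S)) x"
proof -
  have "c (insert i S) * (\<Prod>j\<in>insert i S. chi p (x j)) =
      chi p (x i) * (c (insert i S) * (\<Prod>j\<in>S. chi p (x j)))" if "S \<in> Pow A" for S
  proof -
    have "finite S" "i \<notin> S" using that assms finite_subset by auto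
    then show ?thesis by simp
  qed
  then have "(\<Sum>S\<in>Pow A. c (insert i S) * (\<Prod>j\<in>insert i S. chi p (x j))) =
      (\<Sum>S\<in>Pow A. chi p (x i) * (c (insert i S) * (\<Prod>j\<in>S. chi p (x j))))"
    by (rule sum.cong[OF refl])
  then show ?thesis
    unfolding expansion_def sum_Pow_insert[OF assms] sum_distrib_left by simp
qed

lemma expansion_cong:
  assumes "\<And>S. S \<subseteq> A \<Longrightarrow> c S = c' S" "\<And>i. i \<in> A \<Longrightarrow> x i = y i"
  shows "expansion p A c x = expansion p A c' y"
  unfolding expansion_def
  by (intro sum.cong prod.cong arg_cong2[of _ _ _ _ "(*)"]) (use assms in auto)

lemma expansion_upd [simp]: "i \<notin> A \<Longrightarrow> expansion p A c (x(i := b)) = expansion p A c x"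
  by (rule expansion_cong) auto

lemma expansion_empty [simp]: "expansion p {} c x = c {}"
  by (simp add: expansion_def)

lemma expansion_linear:
  "expansion p A (\<lambda>S. u * c S + w * e S) x = u * expansion p A c x + w * expansion p A e x"
  by (simp add: expansion_def sum.distrib sum_distrib_left algebra_simps)

lemma card_insert_Pow:
  assumes "finite A" "i \<notin> A" "S \<subseteq> A"
  shows "card (insert i S) = Suc (card S)"
  using assms finite_subset by (subst card_insert_disjoint) auto

lemma expansion_damp_insert:
  assumes "finite A" "i \<notin> A"
  shows "expansion p (insert i A) (damp t c) x =
    expansion p A (damp t c) x +
    chi p (x i) * (t * expansion p A (damp t (\<lambda>S. c (insert i S))) x)"
proof -
  have "expansion p A (\<lambda>S. damp t c (insert i S)) x =
      t * expansion p A (damp t (\<lambda>S. c (insert i S))) x + 0 * expansion p A c x"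
    unfolding expansion_linear[symmetric]
    by (rule expansion_cong) (auto simp: damp_def card_insert_Pow[OF assms])
  then show ?thesis
    by (simp add: expansion_insert[OF assms])
qed

lemma expansion_exists:
  assumes "finite A"
  shows "\<exists>c. \<forall>x. Collect x \<subseteq> A \<longrightarrow> f x = expansion p A c x"
  using assms
proof (induction A arbitrary: f rule: finite_induct)
  case empty
  show ?case
    by (intro exI[of _ "\<lambda>_. f (\<lambda>_. False)"]) (auto intro!: arg_cong[of _ _ f])
next
  case (insert i A)
  obtain c1 where c1: "\<And>x. Collect x \<subseteq> A \<Longrightarrow> f (x(i := True)) = expansion p A c1 x"
    using insert.IH[of "\<lambda>x. f (x(i := True))"] by auto
  obtain c0 where c0: "\<And>x. Collect x \<subseteq> A \<Longrightarrow> f (x(i := False)) = expansion p A c0 x"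
    using insert.IH[of "\<lambda>x. f (x(i := False))"] by auto
  \<comment> \<open>Sets avoiding \<open>i\<close> carry the \<open>p\<close>-weighted mean of the
    two restrictions and sets containing \<open>i\<close> their difference. Since \<open>chi\<close>
    takes the values \<open>1 - p\<close> and \<open>-p\<close>, this returns \<open>c1\<close> and
    \<open>c0\<close> respectively.\<close>
  define c where
    "c = (\<lambda>S. if i \<in> S then c1 (S - {i}) - c0 (S - {i}) else p * c1 S + (1 - p) * c0 S)"
  have "f x = expansion p (insert i A) c x" if x: "Collect x \<subseteq> insert i A" for x
  proof -
    have y: "Collect (x(i := False)) \<subseteq> A" using x by (auto split: if_splits)
    have f1: "f (x(i := True)) = expansion p A c1 x"
      using c1[of "x(i := False)"] y insert.hyps by simp
    have f0: "f (x(i := False)) = expansion p A c0 x"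
      using c0[of "x(i := False)"] y insert.hyps by simp
    have a: "expansion p A c x = p * expansion p A c1 x + (1 - p) * expansion p A c0 x"
      unfolding expansion_linear[symmetric]
      by (rule expansion_cong) (use insert.hyps in \<open>auto simp: c_def\<close>)
    have "S - {i} = S" if "S \<subseteq> A" for S using that insert.hyps by auto
    then have b: "expansion p A (\<lambda>S. c (insert i S)) x =
        1 * expansion p A c1 x + (-1) * expansion p A c0 x"
      unfolding expansion_linear[symmetric]
      by (intro expansion_cong) (auto simp: c_def)
    have "f x = (if x i then f (x(i := True)) else f (x(i := False)))"
      by (auto simp: fun_upd_idem)
    also have "\<dots> = expansion p (insert i A) c x"
      unfolding f1 f0 expansion_insert[OF insert.hyps] a b
      by (auto simp: chi_def algebra_simps)
    finally show ?thesis .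
  qed
  then show ?case by blast
qed

section \<open>Orthogonality of characters and the effect of noise\<close>

lemma expect_expansion_mult:
  assumes "0 \<le> p" "p \<le> 1" "finite A"
  shows "expect p A (\<lambda>x. expansion p A c x * expansion p A e x) =
    (\<Sum>S\<in>Pow A. (p * (1 - p)) ^ card S * (c S * e S))"
  using assms(3)
proof (induction A arbitrary: c e rule: finite_induct)
  case (insert i A)
  let ?c = "\<lambda>S. c (insert i S)" and ?e = "\<lambda>S. e (insert i S)"
  have "expect p (insert i A) (\<lambda>x. expansion p (insert i A) c x * expansion p (insert i A) e x) =
     p * expect p A (\<lambda>x. (expansion p A c x + (1 - p) * expansion p A ?c x) *
                        (expansion p A e x + (1 - p) * expansion p A ?e x)) +
     (1 - p) * expect p A (\<lambda>x. (expansion p A c x - p * expansion p A ?c x) *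
                        (expansion p A e x - p * expansion p A ?e x))"
    using insert.hyps assms by (simp add: expect_insert expansion_insert chi_def)
  \<comment> \<open>The mixed terms receive the weights \<open>p * (1 - p)\<close> and
    \<open>- (1 - p) * p\<close> and cancel.\<close>
  also have "\<dots> = expect p A (\<lambda>x. expansion p A c x * expansion p A e x +
      (p * (1 - p)) * (expansion p A ?c x * expansion p A ?e x))"
    unfolding expect_cmult[symmetric] expect_add[OF insert.hyps(1), symmetric]
    by (rule arg_cong[of _ _ "expect p A"]) (rule ext, simp add: algebra_simps)
  also have "\<dots> = (\<Sum>S\<in>Pow A. (p * (1 - p)) ^ card S * (c S * e S)) +
      (p * (1 - p)) * (\<Sum>S\<in>Pow A. (p * (1 - p)) ^ card S * (?c S * ?e S))"
    by (simp add: expect_add insert.hyps expect_cmult insert.IH)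
  also have "\<dots> = (\<Sum>S\<in>Pow (insert i A). (p * (1 - p)) ^ card S * (c S * e S))"
    using insert.hyps by (simp add: sum_Pow_insert card_insert_Pow[OF insert.hyps]
        sum_distrib_left mult.assoc)
  finally show ?case .
qed simp

text \<open>A noisy coordinate is 1 with probability \<open>\<rho> * x i + (1 - \<rho>) * p\<close>,
  so its character has mean \<open>\<rho> * chi p (x i)\<close>. Independence yields one factor
  \<open>\<rho>\<close> per element of \<open>S\<close>.\<close>

lemma expectation_noise_expansion:
  assumes "0 \<le> p" "p \<le> 1" "0 \<le> \<rho>" "\<rho> \<le> 1" "finite A"
  shows "measure_pmf.expectation
      (Pi_pmf A d (\<lambda>i. bind_pmf (bernoulli_pmf \<rho>)
         (\<lambda>keep. if keep then return_pmf (x i) else bernoulli_pmf p))) (expansion p A c) =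
    expansion p A (damp \<rho> c) x"
  using assms(5)
proof (induction A arbitrary: c rule: finite_induct)
  case (insert i A)
  let ?q = "\<lambda>i. bind_pmf (bernoulli_pmf \<rho>)
         (\<lambda>keep. if keep then return_pmf (x i) else bernoulli_pmf p)"
  let ?c = "\<lambda>S. c (insert i S)"
  let ?a = "measure_pmf.expectation (Pi_pmf A d ?q) (expansion p A c)"
  let ?b = "measure_pmf.expectation (Pi_pmf A d ?q) (expansion p A ?c)"
  have int: "integrable (Pi_pmf A d ?q) h" for h :: "_ \<Rightarrow> real"
    by (intro integrable_measure_pmf_finite finite_set_Pi_pmf_bool insert.hyps)
  have t: "pmf (?q i) True = \<rho> * of_bool (x i) + (1 - \<rho>) * p"
    "pmf (?q i) False = 1 - (\<rho> * of_bool (x i) + (1 - \<rho>) * p)"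
    using assms by (simp_all add: pmf_bind algebra_simps)
  have "measure_pmf.expectation (Pi_pmf (insert i A) d ?q) (expansion p (insert i A) c) =
     pmf (?q i) True * (?a + (1 - p) * ?b) + pmf (?q i) False * (?a - p * ?b)"
    using insert.hyps
    by (simp add: expectation_Pi_pmf_insert expansion_insert chi_def int)
  also have "\<dots> = ?a + \<rho> * chi p (x i) * ?b"
    unfolding t chi_def by (simp add: algebra_simps)
  finally show ?case
    using insert.hyps by (simp add: insert.IH expansion_damp_insert)
qed (simp add: damp_def)

section \<open>Recursion for influences\<close>

lemma influence_nonneg: "0 \<le> p \<Longrightarrow> p \<le> 1 \<Longrightarrow> 0 \<le> influence p A R c"
  unfolding influence_def by (intro sum_nonneg) auto

lemma influence_zero [simp]: "influence p A R (\<lambda>_. 0) = 0"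
  unfolding influence_def by (intro sum.neutral) auto

text \<open>When \<open>R\<close> avoids \<open>i\<close>, a set containing \<open>i\<close> has one
  element more outside \<open>R\<close>, hence the extra factor. When \<open>i\<close> is also put
  into \<open>R\<close>, only sets containing \<open>i\<close> survive and the exponent is
  unchanged; that is the companion lemma below.\<close>

lemma influence_insert:
  assumes "finite A" "i \<notin> A" "R \<subseteq> A"
  shows "influence p (insert i A) R c =
    influence p A R c + p * (1 - p) * influence p A R (\<lambda>S. c (insert i S))"
proof -
  have eq: "(if R \<subseteq> insert i S then (p * (1 - p)) ^ (card (insert i S) - card R) * (c (insert i S))\<^sup>2 else 0) =
    p * (1 - p) * (if R \<subseteq> S then (p * (1 - p)) ^ (card S - card R) * (c (insert i S))\<^sup>2 else 0)"
    if S: "S \<in> Pow A" for S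
  proof (cases "R \<subseteq> S")
    case True
    have "finite S" using S assms finite_subset by auto
    then have "card R \<le> card S" using True by (rule card_mono)
    then have "card (insert i S) - card R = Suc (card S - card R)"
      using S assms by (simp add: card_insert_Pow[OF assms(1,2)] Suc_diff_le)
    moreover have "R \<subseteq> insert i S" using True by blast
    ultimately show ?thesis using True by simp
  next
    case False
    then have "\<not> R \<subseteq> insert i S" using assms by blast
    then show ?thesis using False by simp
  qed
  show ?thesis
    unfolding influence_def sum_Pow_insert[OF assms(1,2)] sum_distrib_left
    by (rule arg_cong2[of _ _ _ _ "(+)", OF refl sum.cong[OF refl eq]])
qed

lemma influence_insert_insert:
  assumes "finite A" "i \<notin> A" "R \<subseteq> A"
  shows "influence p (insert i A) (insert i R) c = influence p A R (\<lambda>S. c (insert i S))"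
proof -
  have zero: "(if insert i R \<subseteq> S then (p * (1 - p)) ^ (card S - card (insert i R)) * (c S)\<^sup>2 else 0) = 0"
    if "S \<in> Pow A" for S
    using that assms by auto
  have eq:
    "(if insert i R \<subseteq> insert i S
      then (p * (1 - p)) ^ (card (insert i S) - card (insert i R)) * (c (insert i S))\<^sup>2 else 0) =
     (if R \<subseteq> S then (p * (1 - p)) ^ (card S - card R) * (c (insert i S))\<^sup>2 else 0)"
    if "S \<in> Pow A" for S
  proof -
    have "(insert i R \<subseteq> insert i S) = (R \<subseteq> S)" using assms by blast
    moreover have "card (insert i S) - card (insert i R) = card S - card R"
      using that assms by (simp add: card_insert_Pow[OF assms(1,2)])
    ultimately show ?thesis by presburger
  qed
  show ?thesis
    unfolding influence_def sum_Pow_insert[OF assms(1,2)]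
    by (simp only: sum.neutral[OF ballI[OF zero]] sum.cong[OF refl eq] add_0_left)
qed

section \<open>A hypercontractive inequality for pairs of expansions\<close>

text \<open>The left side is the mean over one biased bit of the product of two squared affine
  functions of \<open>chi\<close>. Halving the slopes makes the error terms small enough to fit
  below coefficient 1.\<close>

lemma two_point_inequality:
  fixes p a b u w :: real
  assumes "0 \<le> p" "p \<le> 1"
  shows "p * ((a + (1 - p) * (1/2 * b))\<^sup>2 * (u + (1 - p) * (1/2 * w))\<^sup>2) +
      (1 - p) * ((a - p * (1/2 * b))\<^sup>2 * (u - p * (1/2 * w))\<^sup>2) \<le>
    a\<^sup>2 * u\<^sup>2 + p * (1 - p) * (a\<^sup>2 * w\<^sup>2 + b\<^sup>2 * u\<^sup>2 + b\<^sup>2 * w\<^sup>2)"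
proof -
  define v where "v = p * (1 - p)"
  have v: "0 \<le> v" using assms by (simp add: v_def)
  \<comment> \<open>This uses the moments of \<open>chi\<close>: the first vanishes, and the second
    to fourth are \<open>v\<close>, \<open>v * (1 - 2 * p)\<close> and
    \<open>v * (1 - 3 * v)\<close>.\<close>
  have eq: "p * ((a + (1 - p) * (1/2 * b))\<^sup>2 * (u + (1 - p) * (1/2 * w))\<^sup>2) +
      (1 - p) * ((a - p * (1/2 * b))\<^sup>2 * (u - p * (1/2 * w))\<^sup>2) =
    a\<^sup>2 * u\<^sup>2 + v * ((a\<^sup>2 * w\<^sup>2 + b\<^sup>2 * u\<^sup>2 + 4 * ((a * w) * (b * u))) / 4 +
      (1 - 2 * p) * ((a * w) * (b * w) + (b * u) * (b * w)) / 4 + (1 - 3 * v) * (b\<^sup>2 * w\<^sup>2) / 16)"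
    unfolding v_def by (simp add: field_simps power2_eq_square)
  have h1: "(a * w) * (b * u) \<le> (a\<^sup>2 * w\<^sup>2 + b\<^sup>2 * u\<^sup>2) / 2"
    using sum_squares_bound[of "a * w" "b * u"] by (simp add: power_mult_distrib)
  have "\<bar>x * z\<bar> \<le> (x\<^sup>2 + z\<^sup>2) / 2" for x z :: real
    using sum_squares_bound[of "\<bar>x\<bar>" "\<bar>z\<bar>"] by (simp add: abs_mult)
  then have ab: "\<bar>x * z + y * z\<bar> \<le> (x\<^sup>2 + z\<^sup>2) / 2 + (y\<^sup>2 + z\<^sup>2) / 2" for x y z :: real
    by (intro order_trans[OF abs_triangle_ineq] add_mono)
  have q: "\<bar>1 - 2 * p\<bar> \<le> 1" using assms by auto
  have "(1 - 2 * p) * ((a * w) * (b * w) + (b * u) * (b * w)) \<le>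
      \<bar>1 - 2 * p\<bar> * \<bar>(a * w) * (b * w) + (b * u) * (b * w)\<bar>"
    by (metis abs_ge_self abs_mult)
  also have "\<dots> \<le> 1 * \<bar>(a * w) * (b * w) + (b * u) * (b * w)\<bar>"
    by (intro mult_right_mono q) simp
  also have "\<dots> \<le> ((a * w)\<^sup>2 + (b * w)\<^sup>2) / 2 + ((b * u)\<^sup>2 + (b * w)\<^sup>2) / 2"
    using ab[of "a * w" "b * w" "b * u"] by simp
  finally have h2: "(1 - 2 * p) * ((a * w) * (b * w) + (b * u) * (b * w)) \<le>
      a\<^sup>2 * w\<^sup>2 / 2 + b\<^sup>2 * u\<^sup>2 / 2 + b\<^sup>2 * w\<^sup>2"
    by (simp add: power_mult_distrib add_divide_distrib)
  have h3: "(1 - 3 * v) * (b\<^sup>2 * w\<^sup>2) \<le> b\<^sup>2 * w\<^sup>2"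
    using mult_right_mono[of "1 - 3 * v" 1 "b\<^sup>2 * w\<^sup>2"] v by simp
  \<comment> \<open>The coefficients of \<open>X\<close> and \<open>Y\<close> add up to at most 3/4
    + 1/8, that of \<open>Z\<close> to at most 1/4 + 1/16.\<close>
  have lin: "(X + Y + 4 * x) / 4 + y / 4 + z / 16 \<le> X + Y + Z"
    if "x \<le> (X + Y) / 2" "y \<le> X / 2 + Y / 2 + Z" "z \<le> Z" "0 \<le> X" "0 \<le> Y" "0 \<le> Z"
    for x y z X Y Z :: real
    using that unfolding add_divide_distrib by linarith
  have nn: "0 \<le> a\<^sup>2 * w\<^sup>2" "0 \<le> b\<^sup>2 * u\<^sup>2" "0 \<le> b\<^sup>2 * w\<^sup>2" by simp_all
  have "(a\<^sup>2 * w\<^sup>2 + b\<^sup>2 * u\<^sup>2 + 4 * ((a * w) * (b * u))) / 4 +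
      (1 - 2 * p) * ((a * w) * (b * w) + (b * u) * (b * w)) / 4 + (1 - 3 * v) * (b\<^sup>2 * w\<^sup>2) / 16
      \<le> a\<^sup>2 * w\<^sup>2 + b\<^sup>2 * u\<^sup>2 + b\<^sup>2 * w\<^sup>2"
    using h1 h2 h3 nn by (rule lin)
  from mult_left_mono[OF this v] show ?thesis
    unfolding eq v_def[symmetric] by linarith
qed

text \<open>With only one function the induction breaks down at the mixed terms; for a pair \<open>c\<close>, \<open>e\<close> the
  cross terms are split pointwise, before taking expectations, into products of two squares to
  which the induction hypothesis applies.\<close>

lemma hypercontractivity:
  assumes "0 \<le> p" "p \<le> 1" "finite A"
  shows "expect p A (\<lambda>x. (expansion p A (damp (1/2) c) x)\<^sup>2 * (expansion p A (damp (1/2) e) x)\<^sup>2)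
    \<le> (\<Sum>R\<in>Pow A. (p * (1 - p)) ^ card R * (influence p A R c * influence p A R e))"
  using assms(3)
proof (induction A arbitrary: c e rule: finite_induct)
  case empty
  show ?case by (simp add: damp_def influence_def)
next
  case (insert i A)
  let ?F = "\<lambda>c. expansion p A (damp (1/2) c)" and ?N = "influence p A"
  let ?c = "\<lambda>S. c (insert i S)" and ?e = "\<lambda>S. e (insert i S)"
  let ?E = "\<lambda>c e. expect p A (\<lambda>x. (?F c x)\<^sup>2 * (?F e x)\<^sup>2)"
  define v where "v = p * (1 - p)"
  have v: "0 \<le> v" using assms by (simp add: v_def)
  note IH = insert.IH[folded v_def]
  have upd: "expansion p (insert i A) (damp (1/2) c) (x(i := b)) =
      ?F c x + chi p b * (1/2 * ?F (\<lambda>S. c (insert i S)) x)"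
    for c x b using insert.hyps by (subst expansion_damp_insert) simp_all
  have "expect p (insert i A) (\<lambda>x. (expansion p (insert i A) (damp (1/2) c) x)\<^sup>2 *
        (expansion p (insert i A) (damp (1/2) e) x)\<^sup>2) =
     expect p A (\<lambda>x. p * ((?F c x + (1 - p) * (1/2 * ?F ?c x))\<^sup>2 * (?F e x + (1 - p) * (1/2 * ?F ?e x))\<^sup>2) +
       (1 - p) * ((?F c x - p * (1/2 * ?F ?c x))\<^sup>2 * (?F e x - p * (1/2 * ?F ?e x))\<^sup>2))"
    unfolding expect_insert[OF assms(1,2) insert.hyps] upd
    by (simp add: expect_add insert.hyps expect_cmult chi_def)
  also have "\<dots> \<le> expect p A (\<lambda>x. (?F c x)\<^sup>2 * (?F e x)\<^sup>2 + v *
      ((?F c x)\<^sup>2 * (?F ?e x)\<^sup>2 + (?F ?c x)\<^sup>2 * (?F e x)\<^sup>2 + (?F ?c x)\<^sup>2 * (?F ?e x)\<^sup>2))"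
    unfolding v_def using assms by (intro expect_mono insert.hyps two_point_inequality)
  also have "\<dots> = ?E c e + v * (?E c ?e + ?E ?c e + ?E ?c ?e)"
    by (simp only: expect_add insert.hyps expect_cmult)
  also have "\<dots> \<le> (\<Sum>R\<in>Pow A. v ^ card R * (?N R c * ?N R e)) + v *
      ((\<Sum>R\<in>Pow A. v ^ card R * (?N R c * ?N R ?e)) +
       (\<Sum>R\<in>Pow A. v ^ card R * (?N R ?c * ?N R e)) +
       (\<Sum>R\<in>Pow A. v ^ card R * (?N R ?c * ?N R ?e)))"
    by (intro add_mono mult_left_mono v IH)
  also have "\<dots> = (\<Sum>R\<in>Pow A. v ^ card R * (?N R c * ?N R e + v * (?N R c * ?N R ?e) +
        v * (?N R ?c * ?N R e))) + (\<Sum>R\<in>Pow A. v * v ^ card R * (?N R ?c * ?N R ?e))"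
    by (simp add: sum_distrib_left sum.distrib distrib_left mult_ac)
  \<comment> \<open>The first three terms make up the product of the two influences on
    \<open>insert i A\<close> at \<open>R\<close>, except for a nonnegative \<open>v * v\<close>
    term, which is added. The fourth sum is the contribution of the sets
    \<open>insert i R\<close>.\<close>
  also have "\<dots> \<le> (\<Sum>R\<in>Pow A. v ^ card R * ((?N R c + v * ?N R ?c) * (?N R e + v * ?N R ?e))) +
      (\<Sum>R\<in>Pow A. v * v ^ card R * (?N R ?c * ?N R ?e))"
  proof (intro add_right_mono sum_mono mult_left_mono)
    fix R
    have "0 \<le> v * v * (?N R ?c * ?N R ?e)"
      using v assms by (intro mult_nonneg_nonneg influence_nonneg)
    then show "?N R c * ?N R e + v * (?N R c * ?N R ?e) + v * (?N R ?c * ?N R e)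
      \<le> (?N R c + v * ?N R ?c) * (?N R e + v * ?N R ?e)"
      by (simp add: algebra_simps)
  qed (use v in simp)
  also have "\<dots> = (\<Sum>R\<in>Pow (insert i A).
      v ^ card R * (influence p (insert i A) R c * influence p (insert i A) R e))"
    unfolding sum_Pow_insert[OF insert.hyps]
    by (intro arg_cong2[of _ _ _ _ "(+)"] sum.cong refl)
      (use insert.hyps in \<open>simp_all add: influence_insert influence_insert_insert
          card_insert_Pow[OF insert.hyps] v_def\<close>)
  finally show ?case unfolding v_def .
qed

section \<open>Influences controlled by restrictions to 1\<close>

lemma influence_empty:
  "influence p A {} c = (\<Sum>S\<in>Pow A. (p * (1 - p)) ^ card S * (c S)\<^sup>2)"
  by (simp add: influence_def)

lemma expect_expansion_square:
  assumes "0 \<le> p" "p \<le> 1" "finite A"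
  shows "expect p A (\<lambda>x. (expansion p A c x)\<^sup>2) = influence p A {} c"
  using expect_expansion_mult[OF assms, of c c] by (simp add: influence_empty power2_eq_square)

lemma influence_cong:
  "(\<And>S. S \<subseteq> A \<Longrightarrow> c S = c' S) \<Longrightarrow> influence p A R c = influence p A R c'"
  unfolding influence_def by (intro sum.cong) auto

text \<open>Conditioning on a coordinate being 0 costs a factor \<open>1 / (1 - p)\<close>. This is
  where \<open>p \<le> 1/2\<close> enters.\<close>

lemma expect_set_False:
  assumes "0 \<le> p" "p \<le> 1/2" "finite A" "i \<in> A" "\<And>x. 0 \<le> h x"
  shows "expect p A (\<lambda>x. h (x(i := False))) \<le> 2 * expect p A h"
proof -
  define B where "B = A - {i}"
  have A: "A = insert i B" "finite B" "i \<notin> B" using assms by (auto simp: B_def)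
  let ?u = "expect p B (\<lambda>x. h (x(i := False)))"
  have "0 \<le> p * expect p B (\<lambda>x. h (x(i := True)))" "0 \<le> ?u"
    using assms by (intro mult_nonneg_nonneg expect_nonneg; simp)+
  moreover have "1/2 * ?u \<le> (1 - p) * ?u"
    using calculation assms by (intro mult_right_mono) auto
  ultimately show ?thesis
    unfolding A(1) using assms A by (simp add: expect_insert algebra_simps)
qed

text \<open>A derivative along \<open>i\<close> is the difference of the restrictions to 1 and to 0.
  Its square is at most twice the sum of their squares, and the restriction to 0 is averaged away at
  a further factor 2. So each \<open>i\<close> in \<open>R\<close> contributes 2 if it lies in
  \<open>T\<close> and 4 if not, and only restrictions to 1 remain, which globalness
  controls.\<close>

lemma influence_le_sum_expect:
  assumes p: "0 \<le> p" "p \<le> 1/2" and A: "finite A" and R: "finite R" "R \<subseteq> A"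
  shows "influence p A R c \<le> 4 ^ card R *
    (\<Sum>T\<in>Pow R. (1/2) ^ card T * expect p A (\<lambda>x. (expansion p A c (\<lambda>j. j \<in> T \<or> x j))\<^sup>2))"
  using R
proof (induction R arbitrary: c rule: finite_induct)
  case empty
  then show ?case using p A by (simp add: expect_expansion_square)
next
  case (insert i R)
  let ?E = "\<lambda>c T. expect p A (\<lambda>x. (expansion p A c (\<lambda>j. j \<in> T \<or> x j))\<^sup>2)"
  define B where "B = A - {i}"
  have AB: "A = insert i B" "finite B" "i \<notin> B" and RB: "R \<subseteq> B" and iA: "i \<in> A"
    using A insert by (auto simp: B_def)
  \<comment> \<open>Coefficients of the derivative along \<open>i\<close>, kept as an expansion over
    all of \<open>A\<close> so that the induction hypothesis for \<open>R\<close> applies on the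
    same index set.\<close>
  define c' where "c' = (\<lambda>S. if i \<in> S then 0 else c (insert i S))"
  have c'0: "(\<lambda>S. c' (insert i S)) = (\<lambda>S. 0)" by (simp add: c'_def)
  have c'B: "c' S = c (insert i S)" if "S \<subseteq> B" for S
    using that AB by (auto simp: c'_def)
  have "influence p A R c' = influence p B R c'"
    unfolding AB(1) influence_insert[OF AB(2,3) RB] c'0 by simp
  also have "\<dots> = influence p A (insert i R) c"
    unfolding AB(1) influence_insert_insert[OF AB(2,3) RB] by (rule influence_cong) (rule c'B)
  finally have inf: "influence p A (insert i R) c = influence p A R c'" ..
  have deriv: "expansion p A c' x =
      expansion p A c (x(i := True)) - expansion p A c (x(i := False))" for x
  proof -
    have "expansion p B c' x = expansion p B (\<lambda>S. c (insert i S)) x"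
      by (rule expansion_cong) (auto simp: c'B)
    then show ?thesis
      using AB unfolding AB(1)
      by (simp add: expansion_insert c'0 chi_def left_diff_distrib) (simp add: expansion_def)
  qed
  have step: "?E c' T \<le> 2 * ?E c (insert i T) + 4 * ?E c T" if "T \<in> Pow R" for T
  proof -
    have iT: "i \<notin> T" using that insert.hyps by auto
    have u1: "(\<lambda>j. j \<in> T \<or> x j)(i := True) = (\<lambda>j. j \<in> insert i T \<or> x j)" for x
      by auto
    have u0: "(\<lambda>j. j \<in> T \<or> x j)(i := False) = (\<lambda>j. j \<in> T \<or> (x(i := False)) j)" for x
      using iT by auto
    have sq: "(a - b)\<^sup>2 \<le> 2 * a\<^sup>2 + 2 * b\<^sup>2" for a b :: real
      using sum_squares_ge_zero[of "a + b" 0] by (simp add: power2_eq_square algebra_simps)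
    have "?E c' T \<le> expect p A (\<lambda>x. 2 * (expansion p A c (\<lambda>j. j \<in> insert i T \<or> x j))\<^sup>2 +
        2 * (expansion p A c (\<lambda>j. j \<in> T \<or> (x(i := False)) j))\<^sup>2)"
      unfolding deriv u1 u0 by (intro expect_mono A sq)
    also have "\<dots> = 2 * ?E c (insert i T) +
        2 * expect p A (\<lambda>x. (expansion p A c (\<lambda>j. j \<in> T \<or> (x(i := False)) j))\<^sup>2)"
      by (simp only: expect_add A expect_cmult)
    also have "\<dots> \<le> 2 * ?E c (insert i T) + 2 * (2 * ?E c T)"
      by (intro add_left_mono mult_left_mono
          expect_set_False[where h = "\<lambda>x. (expansion p A c (\<lambda>j. j \<in> T \<or> x j))\<^sup>2"] p A iA) auto
    finally show ?thesis by simp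
  qed
  have "influence p A (insert i R) c \<le> 4 ^ card R * (\<Sum>T\<in>Pow R. (1/2) ^ card T * ?E c' T)"
    unfolding inf using insert by (intro insert.IH) auto
  also have "\<dots> \<le> 4 ^ card R *
      (\<Sum>T\<in>Pow R. (1/2) ^ card T * (2 * ?E c (insert i T) + 4 * ?E c T))"
    by (intro mult_left_mono sum_mono step) auto
  also have "(\<Sum>T\<in>Pow R. (1/2) ^ card T * (2 * ?E c (insert i T) + 4 * ?E c T)) =
      4 * (\<Sum>T\<in>Pow R. (1/2) ^ card T * ?E c T) +
      4 * (\<Sum>T\<in>Pow R. (1/2) ^ card (insert i T) * ?E c (insert i T))"
    unfolding sum_distrib_left sum.distrib[symmetric]
    by (intro sum.cong refl)
      (simp add: card_insert_Pow[OF insert.hyps] algebra_simps del: insert_iff)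
  also have "4 ^ card R * \<dots> = 4 ^ card (insert i R) *
      (\<Sum>T\<in>Pow (insert i R). (1/2) ^ card T * ?E c T)"
    unfolding sum_Pow_insert[OF insert.hyps] using insert.hyps
    by (simp add: distrib_left mult_ac del: insert_iff)
  finally show ?case .
qed

section \<open>Fourth moments of low-degree expansions\<close>

text \<open>Double counting: after swapping the sums, each \<open>S\<close> is counted once for each
  of its \<open>2 ^ card S\<close> subsets.\<close>

lemma sum_influence:
  assumes "finite A"
  shows "(\<Sum>R\<in>Pow A. (p * (1 - p)) ^ card R * influence p A R c) =
    (\<Sum>S\<in>Pow A. 2 ^ card S * ((p * (1 - p)) ^ card S * (c S)\<^sup>2))"
proof -
  define v where "v = p * (1 - p)"
  have "(\<Sum>R\<in>Pow A. v ^ card R * influence p A R c) =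
    (\<Sum>R\<in>Pow A. \<Sum>S\<in>Pow A. if R \<subseteq> S then v ^ card S * (c S)\<^sup>2 else 0)"
    unfolding influence_def sum_distrib_left v_def[symmetric]
  proof (intro sum.cong refl)
    fix R S assume "R \<in> Pow A" "S \<in> Pow A"
    have "card R \<le> card S" if "R \<subseteq> S"
      using that \<open>S \<in> Pow A\<close> assms by (meson card_mono finite_subset PowD)
    then show "v ^ card R * (if R \<subseteq> S then v ^ (card S - card R) * (c S)\<^sup>2 else 0) =
        (if R \<subseteq> S then v ^ card S * (c S)\<^sup>2 else 0)"
      by (auto simp flip: power_add mult.assoc)
  qed
  also have "\<dots> = (\<Sum>S\<in>Pow A. \<Sum>R\<in>Pow A. if R \<subseteq> S then v ^ card S * (c S)\<^sup>2 else 0)"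
    by (rule sum.swap)
  also have "\<dots> = (\<Sum>S\<in>Pow A. 2 ^ card S * (v ^ card S * (c S)\<^sup>2))"
  proof (intro sum.cong refl)
    fix S assume S: "S \<in> Pow A"
    have "{R \<in> Pow A. R \<subseteq> S} = Pow S" "finite S"
      using S assms finite_subset by auto
    then show "(\<Sum>R\<in>Pow A. if R \<subseteq> S then v ^ card S * (c S)\<^sup>2 else 0) =
        2 ^ card S * (v ^ card S * (c S)\<^sup>2)"
      using assms by (simp add: card_Pow flip: sum.inter_filter)
  qed
  finally show ?thesis unfolding v_def .
qed

text \<open>The constant is 32 = 4 * 2 * 4: one 4 from bounding one influence factor uniformly, the
  2 from summing the other over \<open>R\<close>, and the last 4 from returning from
  \<open>e\<close> to \<open>c\<close>.\<close>

lemma fourth_moment_low_degree: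
  assumes p: "0 \<le> p" "p \<le> 1" and A: "finite A"
    and deg: "\<And>S. S \<subseteq> A \<Longrightarrow> card S > d \<Longrightarrow> c S = 0"
    and \<beta>: "\<And>R. R \<subseteq> A \<Longrightarrow> card R \<le> d \<Longrightarrow> influence p A R c \<le> \<beta>"
  shows "expect p A (\<lambda>x. (expansion p A c x) ^ 4) \<le> 32 ^ d * \<beta> * influence p A {} c"
proof -
  define v where "v = p * (1 - p)"
  have v: "0 \<le> v" using p by (simp add: v_def)
  \<comment> \<open>The rescaling undoes the damping by 1/2 in \<open>hypercontractivity\<close>; in
    degree at most \<open>d\<close> it costs at most \<open>4 ^ d\<close> in squared
    coefficients.\<close>
  define e where "e = (\<lambda>S. 2 ^ card S * c S)"
  have c: "damp (1/2) e = c"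
    by (rule ext) (simp add: damp_def e_def power_one_over)
  have e: "(e S)\<^sup>2 \<le> 4 ^ d * (c S)\<^sup>2" if "S \<subseteq> A" for S
  proof (cases "card S \<le> d")
    case True
    have "(e S)\<^sup>2 = 4 ^ card S * (c S)\<^sup>2"
      by (simp add: e_def power_mult_distrib power2_eq_square flip: power_mult_distrib)
    also have "\<dots> \<le> 4 ^ d * (c S)\<^sup>2"
      using True by (intro mult_right_mono power_increasing) auto
    finally show ?thesis .
  qed (use that deg in \<open>auto simp: e_def not_le\<close>)
  have \<beta>0: "0 \<le> \<beta>"
    using \<beta>[of "{}"] influence_nonneg[OF p, of A "{}" c] by simp
  have N: "influence p A R e \<le> 4 ^ d * \<beta>" if R: "R \<subseteq> A" for R
  proof (cases "card R \<le> d")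
    case True
    have "influence p A R e \<le> 4 ^ d * influence p A R c"
      unfolding influence_def sum_distrib_left v_def[symmetric]
    proof (intro sum_mono)
      fix S assume "S \<in> Pow A"
      then have "v ^ (card S - card R) * (e S)\<^sup>2 \<le> v ^ (card S - card R) * (4 ^ d * (c S)\<^sup>2)"
        using v by (intro mult_left_mono e) auto
      then show "(if R \<subseteq> S then v ^ (card S - card R) * (e S)\<^sup>2 else 0) \<le>
          4 ^ d * (if R \<subseteq> S then v ^ (card S - card R) * (c S)\<^sup>2 else 0)"
        by (simp add: mult_ac)
    qed
    also have "\<dots> \<le> 4 ^ d * \<beta>"
      using \<beta>[OF R True] by (intro mult_left_mono) auto
    finally show ?thesis .
  next
    case False
    have "e S = 0" if "S \<in> Pow A" "R \<subseteq> S" for S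
    proof -
      have "card R \<le> card S" using that A by (meson card_mono finite_subset PowD)
      then show ?thesis using False deg[of S] that by (simp add: e_def)
    qed
    then have "influence p A R e = 0"
      unfolding influence_def by (intro sum.neutral) auto
    then show ?thesis using \<beta>0 by simp
  qed
  have "expect p A (\<lambda>x. (expansion p A c x) ^ 4) =
      expect p A (\<lambda>x. (expansion p A (damp (1/2) e) x)\<^sup>2 * (expansion p A (damp (1/2) e) x)\<^sup>2)"
    unfolding c by (simp flip: power_add)
  also have "\<dots> \<le> (\<Sum>R\<in>Pow A. v ^ card R * (influence p A R e * influence p A R e))"
    unfolding v_def using p A by (rule hypercontractivity)
  also have "\<dots> \<le> (\<Sum>R\<in>Pow A. v ^ card R * (4 ^ d * \<beta> * influence p A R e))"
    using v p by (intro sum_mono mult_left_mono mult_right_mono N influence_nonneg) auto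
  also have "\<dots> = 4 ^ d * \<beta> * (\<Sum>S\<in>Pow A. 2 ^ card S * (v ^ card S * (e S)\<^sup>2))"
    unfolding v_def sum_influence[OF A, symmetric] sum_distrib_left
    by (intro sum.cong refl) (simp add: mult_ac)
  also have "\<dots> \<le> 4 ^ d * \<beta> * (\<Sum>S\<in>Pow A. 2 ^ d * (v ^ card S * (4 ^ d * (c S)\<^sup>2)))"
  proof (intro mult_left_mono sum_mono)
    fix S assume S: "S \<in> Pow A"
    show "2 ^ card S * (v ^ card S * (e S)\<^sup>2) \<le> 2 ^ d * (v ^ card S * (4 ^ d * (c S)\<^sup>2))"
    proof (cases "card S \<le> d")
      case True
      then show ?thesis
        using S v by (intro mult_mono mult_left_mono e power_increasing) auto
    qed (use S deg v in \<open>auto simp: e_def not_le\<close>)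
  qed (use \<beta>0 in simp)
  also have "\<dots> = (4 * 2 * 4) ^ d * \<beta> * influence p A {} c"
    unfolding influence_empty v_def[symmetric] power_mult_distrib sum_distrib_left
    by (intro sum.cong refl) (simp add: mult_ac)
  finally show ?thesis by simp
qed

section \<open>Low-degree weight of global Boolean functions\<close>

text \<open>The quartic is tangent to the identity at \<open>g = s\<close>, so the difference has
  the double root exhibited in the proof.\<close>

lemma young_quartic:
  fixes g s :: real
  assumes "0 < s"
  shows "g \<le> 3/4 * s + g ^ 4 / (4 * s ^ 3)"
proof -
  have "0 \<le> (g - s)\<^sup>2 * ((g + s)\<^sup>2 + 2 * s\<^sup>2)"
    by simp
  also have "\<dots> = 4 * s ^ 3 * (3/4 * s + g ^ 4 / (4 * s ^ 3) - g)"
    using assms by (simp add: field_simps power2_eq_square power3_eq_cube power4_eq_xxxx)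
  finally show ?thesis
    using assms by (simp add: zero_le_mult_iff)
qed

text \<open>The factor \<open>2 ^ card T\<close> in the globalness hypothesis cancels the
  \<open>(1/2) ^ card T\<close> of \<open>influence_le_sum_expect\<close>. Each subset of
  \<open>R\<close> then contributes \<open>\<delta>\<close>, so influences are at most
  \<open>8 ^ d * \<delta>\<close>, and 256 = 32 * 8.\<close>

lemma low_degree_weight_le:
  assumes p: "0 \<le> p" "p \<le> 1/2" and A: "finite A"
    and bool: "\<And>x. Collect x \<subseteq> A \<Longrightarrow> f x \<in> {0, 1}"
    and c: "\<And>x. Collect x \<subseteq> A \<Longrightarrow> f x = expansion p A c x"
    and global: "\<And>T. T \<subseteq> A \<Longrightarrow> card T \<le> d \<Longrightarrow>
      expect p A (\<lambda>x. f (\<lambda>j. j \<in> T \<or> x j)) \<le> 2 ^ card T * \<delta>"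
    and s: "0 < s" "256 ^ d * \<delta> \<le> s ^ 3"
  shows "(\<Sum>S\<in>Pow A. if card S \<le> d then (p * (1 - p)) ^ card S * (c S)\<^sup>2 else 0)
    \<le> s * expect p A f"
proof -
  define v where "v = p * (1 - p)"
  have v: "0 \<le> v" using p by (simp add: v_def)
  have p1: "p \<le> 1" using p by simp
  define c' where "c' = (\<lambda>S. if card S \<le> d then c S else 0)"
  define g where "g = expansion p A c'"
  define W where "W = influence p A {} c'"
  have W: "W = (\<Sum>S\<in>Pow A. if card S \<le> d then v ^ card S * (c S)\<^sup>2 else 0)"
    unfolding W_def influence_empty c'_def v_def by (intro sum.cong) auto
  have W0: "0 \<le> W" unfolding W_def using p p1 by (simp add: influence_nonneg)
  have inf: "influence p A R c' \<le> 8 ^ d * \<delta>" if R: "R \<subseteq> A" "card R \<le> d" for R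
  proof -
    have fR: "finite R" using R A finite_subset by blast
    have "expect p A (\<lambda>_. 0) \<le> expect p A f"
    proof (intro expect_mono A)
      fix x assume "Collect x \<subseteq> A"
      from bool[OF this] show "0 \<le> f x" by auto
    qed
    then have \<delta>: "0 \<le> \<delta>" using global[of "{}"] by simp
    have "influence p A R c' \<le> influence p A R c"
      unfolding influence_def c'_def v_def[symmetric] using v by (intro sum_mono) auto
    also have "\<dots> \<le> 4 ^ card R * (\<Sum>T\<in>Pow R. (1/2) ^ card T *
        expect p A (\<lambda>x. (expansion p A c (\<lambda>j. j \<in> T \<or> x j))\<^sup>2))"
      using p A fR R by (intro influence_le_sum_expect)
    also have "\<dots> \<le> 4 ^ card R * (\<Sum>T\<in>Pow R. \<delta>)"
    proof (intro mult_left_mono sum_mono)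
      fix T assume T: "T \<in> Pow R"
      have "expect p A (\<lambda>x. (expansion p A c (\<lambda>j. j \<in> T \<or> x j))\<^sup>2) =
          expect p A (\<lambda>x. f (\<lambda>j. j \<in> T \<or> x j))"
      proof (intro expect_cong A)
        fix x assume x: "Collect x \<subseteq> A"
        let ?y = "\<lambda>j. j \<in> T \<or> x j"
        have "Collect ?y \<subseteq> A" using x T R by auto
        then have "f ?y \<in> {0, 1}" "f ?y = expansion p A c ?y"
          by (rule bool c)+
        then show "(expansion p A c ?y)\<^sup>2 = f ?y" by auto
      qed
      also have "\<dots> \<le> 2 ^ card T * \<delta>"
        using T R fR card_mono[of R T] by (intro global) auto
      finally have "(1/2) ^ card T * expect p A (\<lambda>x. (expansion p A c (\<lambda>j. j \<in> T \<or> x j))\<^sup>2)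
          \<le> (1/2) ^ card T * (2 ^ card T * \<delta>)"
        by (intro mult_left_mono) auto
      then show "(1/2) ^ card T * expect p A (\<lambda>x. (expansion p A c (\<lambda>j. j \<in> T \<or> x j))\<^sup>2) \<le> \<delta>"
        by (simp add: power_one_over)
    qed simp
    also have "\<dots> = (4 * 2) ^ card R * \<delta>"
      unfolding power_mult_distrib using fR by (simp add: card_Pow)
    also have "\<dots> \<le> 8 ^ d * \<delta>"
      using R \<delta> by (intro mult_mono) (auto intro: power_increasing)
    finally show ?thesis .
  qed
  have "expect p A (\<lambda>x. g x ^ 4) \<le> 32 ^ d * (8 ^ d * \<delta>) * W"
    unfolding g_def W_def using p p1 A inf
    by (intro fourth_moment_low_degree) (auto simp: c'_def)
  also have "\<dots> = 256 ^ d * \<delta> * W"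
    by (simp flip: power_mult_distrib mult.assoc)
  also have "\<dots> \<le> s ^ 3 * W"
    using s W0 by (intro mult_right_mono)
  finally have g4: "expect p A (\<lambda>x. g x ^ 4) / (4 * s ^ 3) \<le> W / 4"
    using s by (simp add: field_simps)
  \<comment> \<open>By orthogonality, pairing \<open>f\<close> with its truncation \<open>g\<close>
    sees only the low-degree coefficients.\<close>
  have "W = expect p A (\<lambda>x. expansion p A c x * g x)"
    unfolding g_def expect_expansion_mult[OF p(1) p1 A] W_def influence_empty
    by (intro sum.cong) (auto simp: c'_def power2_eq_square)
  \<comment> \<open>\<open>young_quartic\<close> is needed only where \<open>f x = 1\<close>, so its
    linear term is paid on the support of \<open>f\<close> only; where \<open>f x = 0\<close> the
    left side vanishes.\<close>
  also have "\<dots> \<le> expect p A (\<lambda>x. 3/4 * s * f x + 1 / (4 * s ^ 3) * g x ^ 4)"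
  proof (intro expect_mono A)
    fix x assume x: "Collect x \<subseteq> A"
    then show "expansion p A c x * g x \<le> 3/4 * s * f x + 1 / (4 * s ^ 3) * g x ^ 4"
      using bool[OF x] c[OF x] young_quartic[OF s(1), of "g x"] s(1) by auto
  qed
  also have "\<dots> = 3/4 * s * expect p A f + expect p A (\<lambda>x. g x ^ 4) / (4 * s ^ 3)"
    unfolding expect_add[OF A] expect_cmult by simp
  \<comment> \<open>The quartic term is at most \<open>W / 4\<close> and is absorbed on the left,
    leaving \<open>3/4 * W \<le> 3/4 * s * expect p A f\<close>.\<close>
  finally show ?thesis
    using g4 unfolding W[symmetric, unfolded v_def] by linarith
qed

section \<open>Noise stability of sparse global functions\<close>

theorem theorem10p1:
  fixes n :: nat and p \<rho> \<epsilon> r \<delta> :: real and f :: "(nat \<Rightarrow> bool) \<Rightarrow> real"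
  assumes "0 < p" and "p \<le> 1 / 2"
    and "0 < \<rho>" and "\<rho> < 1"
    and "0 < \<epsilon>"
    and "r = ln (2 / \<epsilon>) / ln (1 / \<rho>)"
    and "\<delta> = 10 powr (- 3 * r - 1) * \<epsilon> ^ 3"
    and "\<And>x. x \<in> cube n \<Longrightarrow> f x \<in> {0, 1}"
    and "is_global n p r \<delta> f"
    and "mu n p f < \<delta>"
  shows "Stab n p \<rho> f \<le> \<epsilon> * mu n p f"
proof -
  define A where "A = {..<n}"
  have A: "finite A" by (simp add: A_def)
  define v where "v = p * (1 - p)"
  have v: "0 \<le> v" using assms by (simp add: v_def)
  have p: "0 \<le> p" "p \<le> 1" and \<rho>: "0 \<le> \<rho>" "\<rho> \<le> 1" using assms by auto
  have mu: "mu n p h = expect p A h" for h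
    by (simp add: mu_def biased_pmf_def expect_def A_def)
  have bool: "f x \<in> {0, 1}" if "Collect x \<subseteq> A" for x
    using that assms(8)[of x] by (auto simp: cube_def PiE_dflt_def A_def)
  obtain c where "\<forall>x. Collect x \<subseteq> A \<longrightarrow> f x = expansion p A c x"
    using expansion_exists[OF A] by blast
  then have c: "f x = expansion p A c x" if "Collect x \<subseteq> A" for x
    using that by blast
  have "expect p A f = expect p A (\<lambda>x. (expansion p A c x)\<^sup>2)"
  proof (intro expect_cong A)
    fix x assume x: "Collect x \<subseteq> A"
    show "f x = (expansion p A c x)\<^sup>2" using bool[OF x] c[OF x] by force
  qed
  then have parseval: "expect p A f = (\<Sum>S\<in>Pow A. v ^ card S * (c S)\<^sup>2)"
    using p A by (simp add: expect_expansion_square influence_empty v_def)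
  then have mu0: "0 \<le> expect p A f"
    using v by (simp add: sum_nonneg)
  \<comment> \<open>This holds at every \<open>x\<close>, although \<open>f\<close> is known to
    equal its expansion only on the cube: the noisy sample is always \<open>False\<close> off
    \<open>A\<close>.\<close>
  have noise: "noise_op n p \<rho> f x = expansion p A (damp \<rho> c) x" for x
  proof -
    have "noise_op n p \<rho> f x = measure_pmf.expectation (noise_pmf n p \<rho> x) (expansion p A c)"
      unfolding noise_op_def
    proof (intro integral_cong_AE AE_pmfI)
      fix y assume "y \<in> set_pmf (noise_pmf n p \<rho> x)"
      then have "Collect y \<subseteq> A"
        using set_Pi_pmf_subset[OF A] unfolding noise_pmf_def A_def[symmetric] by fastforce
      then show "f y = expansion p A c y" by (rule c)
    qed auto
    then show ?thesis
      unfolding noise_pmf_def A_def[symmetric] by (simp add: expectation_noise_expansion p \<rho> A)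
  qed
  have "Stab n p \<rho> f = expect p A (\<lambda>x. expansion p A c x * expansion p A (damp \<rho> c) x)"
    unfolding Stab_def mu noise by (intro expect_cong A) (simp add: c)
  also have "\<dots> = (\<Sum>S\<in>Pow A. \<rho> ^ card S * (v ^ card S * (c S)\<^sup>2))"
    unfolding expect_expansion_mult[OF p A] v_def
    by (intro sum.cong) (auto simp: damp_def power2_eq_square)
  finally have stab: "Stab n p \<rho> f = (\<Sum>S\<in>Pow A. \<rho> ^ card S * (v ^ card S * (c S)\<^sup>2))" .
  have term0: "0 \<le> v ^ card S * (c S)\<^sup>2" for S using v by simp
  have term1: "\<rho> ^ card S * (v ^ card S * (c S)\<^sup>2) \<le> v ^ card S * (c S)\<^sup>2" for S
    using \<rho> term0[of S] by (intro mult_left_le_one_le power_le_one) auto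
  show ?thesis
  \<comment> \<open>For \<open>\<epsilon> \<ge> 1\<close> the bound follows from stability being at
    most the mean. The other case ensures \<open>r \<ge> 0\<close>, so that rounding
    \<open>r\<close> down to a natural number is faithful.\<close>
  proof (cases "\<epsilon> \<ge> 1")
    case True
    have "Stab n p \<rho> f \<le> 1 * expect p A f"
      unfolding stab parseval by (simp add: sum_mono term1)
    also have "\<dots> \<le> \<epsilon> * expect p A f"
      using True mu0 by (rule mult_right_mono)
    finally show ?thesis unfolding mu .
  next
    case False
    have l: "0 < ln (1 / \<rho>)" using assms by simp
    have r0: "0 \<le> r"
      unfolding assms(6) using False assms(5) l by (intro divide_nonneg_pos ln_ge_zero) auto
    define d where "d = nat \<lfloor>r\<rfloor>"
    have d: "real k \<le> r \<longleftrightarrow> k \<le> d" for k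
      unfolding d_def using r0 by (simp add: le_nat_floor le_nat_iff le_floor_iff)
    have "r * ln \<rho> = ln (\<epsilon> / 2)"
      using l assms by (simp add: ln_div)
    then have \<rho>r: "\<rho> powr r = \<epsilon> / 2"
      using assms by (simp add: powr_def)
    \<comment> \<open>Smallness of the mean settles \<open>T = {}\<close>; for nonempty
      \<open>T\<close>, globalness and smallness together give \<open>2 * \<delta>\<close>, which is
      at most \<open>2 ^ card T * \<delta>\<close>.\<close>
    have global: "expect p A (\<lambda>x. f (\<lambda>j. j \<in> T \<or> x j)) \<le> 2 ^ card T * \<delta>"
      if T: "T \<subseteq> A" "card T \<le> d" for T
    proof (cases "T = {}")
      case True
      then show ?thesis using assms(10) by (simp add: mu)
    next
      case False
      then have "card T \<noteq> 0" using T A finite_subset[of T A] by auto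
      then have two: "(2::real) \<le> 2 ^ card T"
        using power_increasing[of 1 "card T" "2::real"] by simp
      have "mu n p (restrict_to_1 T f) \<le> mu n p f + \<delta>"
        using assms(9) T d unfolding is_global_def A_def by blast
      moreover have "restrict_to_1 T f = (\<lambda>x. f (\<lambda>j. j \<in> T \<or> x j))"
        by (auto simp: restrict_to_1_def intro!: ext arg_cong[of _ _ f])
      ultimately have "expect p A (\<lambda>x. f (\<lambda>j. j \<in> T \<or> x j)) \<le> 2 * \<delta>"
        using assms(10) by (simp add: mu)
      also have "\<dots> \<le> 2 ^ card T * \<delta>"
        using two assms(10) mu0 by (intro mult_right_mono) (auto simp: mu)
      finally show ?thesis .
    qed
    \<comment> \<open>The factor \<open>10 powr (- 3 * r)\<close> in \<open>\<delta>\<close> pays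
      for \<open>256 ^ d\<close>, as 256 is below 1000 and \<open>d \<le> r\<close>. The remaining
      1/10 is below 1/8, the cube of the 1/2 in \<open>s = \<epsilon> / 2\<close>.\<close>
    have "(256::real) ^ d \<le> 1000 ^ d"
      by (rule power_mono) auto
    also have "\<dots> = 10 powr (3 * real d)"
      by (simp add: powr_mult powr_realpow[symmetric] flip: powr_powr)
    also have "\<dots> \<le> 10 powr (3 * r)"
      using d[of d] by (intro powr_mono) auto
    finally have "256 ^ d * \<delta> \<le> 10 powr (3 * r) * \<delta>"
      using assms by (intro mult_right_mono) auto
    also have "\<dots> = \<epsilon> ^ 3 / 10"
      unfolding assms(7) by (simp add: powr_minus powr_diff field_simps)
    also have "\<dots> \<le> (\<epsilon> / 2) ^ 3"
      using assms(5) by (simp add: power_divide)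
    finally have \<delta>: "256 ^ d * \<delta> \<le> (\<epsilon> / 2) ^ 3" .
    have low: "(\<Sum>S\<in>Pow A. if card S \<le> d then v ^ card S * (c S)\<^sup>2 else 0) \<le>
        \<epsilon> / 2 * expect p A f"
      unfolding v_def using p(1) assms(2) A bool c global
        half_gt_zero[OF assms(5)] \<delta>
      by (rule low_degree_weight_le)
    \<comment> \<open>Degrees up to \<open>d\<close> are charged their full weight. Above
      \<open>d\<close> the damping is at most \<open>\<rho> powr r = \<epsilon> / 2\<close>; that
      bound is nonnegative and is simply added for all \<open>S\<close>.\<close>
    have "Stab n p \<rho> f \<le> (\<Sum>S\<in>Pow A. (if card S \<le> d then v ^ card S * (c S)\<^sup>2 else 0) +
        \<epsilon> / 2 * (v ^ card S * (c S)\<^sup>2))"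
      unfolding stab
    proof (intro sum_mono)
      fix S
      show "\<rho> ^ card S * (v ^ card S * (c S)\<^sup>2) \<le>
          (if card S \<le> d then v ^ card S * (c S)\<^sup>2 else 0) + \<epsilon> / 2 * (v ^ card S * (c S)\<^sup>2)"
      proof (cases "card S \<le> d")
        case True
        then show ?thesis
          using term1[of S] mult_nonneg_nonneg[OF _ term0[of S], of "\<epsilon> / 2"] assms(5) by simp
      next
        case False
        then have "r \<le> real (card S)" using d[of "card S"] by simp
        then have "\<rho> powr real (card S) \<le> \<rho> powr r"
          using assms by (intro powr_mono') auto
        then have "\<rho> ^ card S \<le> \<epsilon> / 2"
          using \<rho>r assms(3) by (simp add: powr_realpow)
        from mult_right_mono[OF this term0[of S]] show ?thesis
          using False by simp
      qed
    qed
    also have "\<dots> = (\<Sum>S\<in>Pow A. if card S \<le> d then v ^ card S * (c S)\<^sup>2 else 0) +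
        \<epsilon> / 2 * expect p A f"
      by (simp add: sum.distrib sum_distrib_left parseval)
    also have "\<dots> \<le> \<epsilon> * expect p A f"
      using low by (simp add: algebra_simps)
    finally show ?thesis unfolding mu .
  qed
qed

end
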